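(* Let $G$ be a finite simple graph with nonempty vertex set. Then the circular altitude of $G$ equals the maximum of the circular altitudes of its blocks, i.e. $\alpha^o(G)=\max\{\alpha^o(B) \mid B \text{ is a block of } G\}$.
   Context: All graphs are simple, with finite and nonempty vertex set; $V(G)$ and $E(G)$ denote the vertex set and edge set of $G$. Circular altitude: a linear ordering of $V(G)$ is a bijection $\mathcal{U}:\{1,2,\ldots,|V(G)|\}\to V(G)$; write $u_i=\mathcal{U}(i)$. A $\mathcal{U}$-monotonic cycle of length $m$ ($m\ge 1$) is a sequence $u_{i_1},u_{i_2},\ldots,u_{i_m}$ of $m$ pairwise distinct vertices of $G$ such that, whenever $m>1$: (i) $i_1<i_2<\cdots<i_m$; (ii) $u_{i_t}$ and $u_{i_{t+1}}$ are adjacent for each $1\le t\le m-1$; (iii) $u_{i_m}$ and $u_{i_1}$ are adjacent. (So a single vertex is a monotonic cycle of length $1$, and an edge gives one of length $2$.) Let $|\mathcal{U}|$ denote the maximum length of a $\mathcal{U}$-monotonic cycle. The circular altitude $\alpha^o(G)$ is the minimum of $|\mathcal{U}|$ over all linear orderings $\mathcal{U}$ of $V(G)$. Blocks: a cut-vertex of a graph is a vertex whose removal results in a graph with a higher number of connected components. A graph is nonseparable if it is connected and has no cut-vertices. A block of $G$ is a maximal nonseparable subgraph of $G$, i.e. a nonseparable subgraph of $G$ that is not a subgraph of another nonseparable subgraph of $G$. *)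

theory Defs
  imports "Graph_Theory.Digraph_Component"
begin

text \<open>
  A finite simple graph is an element of the locale \<^locale>\<open>graph\<close> (a finite, loop-free, symmetric
  digraph without parallel arcs), so an edge is a pair of opposite arcs and \<open>u \<rightarrow>\<^bsub>G\<^esub> v\<close> is
  adjacency. The locale admits the null graph, hence non-emptiness has to be assumed separately;
  \<^const>\<open>connected\<close> implies it.
\<close>

definition linear_ordering :: "('a, 'b) pre_digraph \<Rightarrow> (nat \<Rightarrow> 'a) \<Rightarrow> bool" where
  "linear_ordering G U \<longleftrightarrow> bij_betw U {1..card (verts G)} (verts G)"

text \<open>A cycle \<open>U i\<^sub>1, \<dots>, U i\<^sub>m\<close> is represented by its list of indices \<open>[i\<^sub>1, \<dots>, i\<^sub>m]\<close>.\<close>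

definition monotonic_cycle :: "('a, 'b) pre_digraph \<Rightarrow> (nat \<Rightarrow> 'a) \<Rightarrow> nat list \<Rightarrow> bool" where
  "monotonic_cycle G U ks \<longleftrightarrow>
     length ks \<ge> 1 \<and> set ks \<subseteq> {1..card (verts G)} \<and> distinct (map U ks) \<and>
     (length ks > 1 \<longrightarrow>
        sorted_wrt (<) ks \<and>
        (\<forall>t. Suc t < length ks \<longrightarrow> U (ks ! t) \<rightarrow>\<^bsub>G\<^esub> U (ks ! Suc t)) \<and>
        U (last ks) \<rightarrow>\<^bsub>G\<^esub> U (hd ks))"

definition ordering_altitude :: "('a, 'b) pre_digraph \<Rightarrow> (nat \<Rightarrow> 'a) \<Rightarrow> nat" where
  "ordering_altitude G U = Max {length ks |ks. monotonic_cycle G U ks}"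

definition circular_altitude :: "('a, 'b) pre_digraph \<Rightarrow> nat" where
  "circular_altitude G = Min {ordering_altitude G U |U. linear_ordering G U}"

text \<open>
  In a symmetric digraph the strongly connected components are the connected components of the
  undirected graph.
\<close>

definition cut_vertex :: "('a, 'b) pre_digraph \<Rightarrow> 'a \<Rightarrow> bool" where
  "cut_vertex G v \<longleftrightarrow> v \<in> verts G \<and>
     card (pre_digraph.sccs (pre_digraph.del_vert G v)) > card (pre_digraph.sccs G)"

definition nonseparable :: "('a, 'b) pre_digraph \<Rightarrow> bool" where
  "nonseparable G \<longleftrightarrow> connected G \<and> (\<nexists>v. cut_vertex G v)"

text \<open>
  The relation \<^const>\<open>subgraph\<close> also relates digraphs; requiring \<^const>\<open>graph\<close> keeps only those
  subgraphs that contain both arcs of each of their edges.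
\<close>

definition nonseparable_subgraph :: "('a, 'b) pre_digraph \<Rightarrow> ('a, 'b) pre_digraph \<Rightarrow> bool" where
  "nonseparable_subgraph H G \<longleftrightarrow> graph H \<and> subgraph H G \<and> nonseparable H"

definition block :: "('a, 'b) pre_digraph \<Rightarrow> ('a, 'b) pre_digraph \<Rightarrow> bool" where
  "block B G \<longleftrightarrow> nonseparable_subgraph B G \<and>
     \<not> (\<exists>H. nonseparable_subgraph H G \<and> H \<noteq> B \<and> subgraph B H)"

end

theory Submission
  imports Defs "HOL-Library.Sublist"
begin

text \<open>
  Restricting an ordering of \<open>G\<close> to a subgraph cannot lengthen its monotonic cycles, so the circular
  altitude is monotone under subgraphs. Conversely, a graph that is not nonseparable splits into two
  proper induced subgraphs that share at most a cut-vertex \<open>v\<close> and have no further edges between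
  them. Cyclic shifts of an ordering preserve its monotonic cycles up to rotation, so optimal
  orderings of both parts may be assumed to start with \<open>v\<close>. List \<open>v\<close>, then the rest of the first
  part, then the rest of the second part: a monotonic cycle meeting both rests would contain an edge
  between them. Hence one of the parts has at least the circular altitude of the whole graph, and by
  induction so does some nonseparable subgraph, which extends to a block.
\<close>

subsection \<open>Closed walks and orderings as lists\<close>

text \<open>The order-free half of a monotonic cycle; order and distinctness come from being a
  subsequence of a distinct list. The length guard admits single vertices although adjacency is
  irreflexive.\<close>

definition closed_walk :: "('a \<Rightarrow> 'a \<Rightarrow> bool) \<Rightarrow> 'a list \<Rightarrow> bool" where
  "closed_walk R ys \<longleftrightarrow>
     ys \<noteq> [] \<and> (length ys > 1 \<longrightarrow> successively R ys \<and> R (last ys) (hd ys))"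

text \<open>Stating a bound instead of a maximum turns the later \<open>Max\<close> and
  \<open>Min\<close> into plain quantifiers.\<close>

definition altitude_le :: "('a \<Rightarrow> 'a \<Rightarrow> bool) \<Rightarrow> 'a list \<Rightarrow> nat \<Rightarrow> bool" where
  "altitude_le R xs k \<longleftrightarrow> (\<forall>ys. subseq ys xs \<longrightarrow> closed_walk R ys \<longrightarrow> length ys \<le> k)"

lemma altitude_leD: "altitude_le R xs k \<Longrightarrow> subseq ys xs \<Longrightarrow> closed_walk R ys \<Longrightarrow> length ys \<le> k"
  by (simp add: altitude_le_def)

lemma closed_walk_mono:
  assumes "closed_walk R ys" and "\<And>x y. x \<in> set ys \<Longrightarrow> y \<in> set ys \<Longrightarrow> R x y \<Longrightarrow> Q x y"
  shows "closed_walk Q ys"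
  using assms by (auto simp: closed_walk_def intro: successively_mono)

text \<open>The step joining the two pieces and the closing step exchange roles.\<close>

lemma closed_walk_rotate:
  assumes "closed_walk R (xs @ ys)"
  shows "closed_walk R (ys @ xs)"
proof (cases "xs = [] \<or> ys = []")
  case False
  then have "length (xs @ ys) > 1"
    by (cases xs; cases ys) auto
  then show ?thesis
    using assms False by (auto simp: closed_walk_def successively_append_iff)
qed (use assms in auto)

lemma closed_walk_map:
  "closed_walk R (map f ks) \<longleftrightarrow> ks \<noteq> [] \<and> (length ks > 1 \<longrightarrow>
    (\<forall>t. Suc t < length ks \<longrightarrow> R (f (ks ! t)) (f (ks ! Suc t))) \<and> R (f (last ks)) (f (hd ks)))"
  by (cases "ks = []") (simp_all add: closed_walk_def successively_conv_nth last_map hd_map)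

lemma set_mono_subseq: "subseq xs ys \<Longrightarrow> set xs \<subseteq> set ys"
  by (auto simp: subseq_conv_nths dest: in_set_nthsD)

lemma altitude_le_mono:
  assumes "altitude_le R xs k" and "\<And>x y. x \<in> set xs \<Longrightarrow> y \<in> set xs \<Longrightarrow> Q x y \<Longrightarrow> R x y"
  shows "altitude_le Q xs k"
  unfolding altitude_le_def
proof (intro allI impI)
  fix ys assume ys: "subseq ys xs" "closed_walk Q ys"
  then have "set ys \<subseteq> set xs"
    by (simp add: set_mono_subseq)
  then have "closed_walk R ys"
    using closed_walk_mono[OF ys(2)] assms(2) by blast
  then show "length ys \<le> k"
    using ys(1) assms(1) by (simp add: altitude_leD)
qed

lemma altitude_le_subseq: "altitude_le R xs k \<Longrightarrow> subseq ys xs \<Longrightarrow> altitude_le R ys k"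
  unfolding altitude_le_def using subseq_order.trans by blast

text \<open>A subsequence of the shifted list splits along the cut; swapping its pieces gives a
  closed walk of the same length in the original list.\<close>

lemma altitude_le_rotate:
  assumes "altitude_le R (xs @ ys) k"
  shows "altitude_le R (ys @ xs) k"
  unfolding altitude_le_def
proof (intro allI impI)
  fix zs assume zs: "subseq zs (ys @ xs)" "closed_walk R zs"
  then obtain us vs where uv: "zs = us @ vs" "subseq us ys" "subseq vs xs"
    by (auto elim: subseq_appendE)
  then have "subseq (vs @ us) (xs @ ys)" and "closed_walk R (vs @ us)"
    using zs closed_walk_rotate by (auto simp: list_emb_append_mono)
  then have "length (vs @ us) \<le> k"
    using assms by (blast dest: altitude_leD)
  then show "length zs \<le> k"
    by (simp add: uv)
qed

text \<open>A closed walk that avoids \<open>as\<close> or \<open>bs\<close> lies in one of the two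
  shorter lists; one that meets both would have to step directly from \<open>as\<close> to
  \<open>bs\<close>.\<close>

lemma altitude_le_append:
  assumes "altitude_le R (ps @ as) k" and "altitude_le R (ps @ bs) k"
    and no: "\<And>a b. a \<in> set as \<Longrightarrow> b \<in> set bs \<Longrightarrow> \<not> R a b"
  shows "altitude_le R (ps @ as @ bs) k"
  unfolding altitude_le_def
proof (intro allI impI)
  fix zs assume zs: "subseq zs (ps @ as @ bs)" "closed_walk R zs"
  then obtain us vs ws where z: "zs = us @ vs @ ws" "subseq us ps" "subseq vs as" "subseq ws bs"
    by (metis subseq_appendE)
  show "length zs \<le> k"
  proof (cases "vs = [] \<or> ws = []")
    case True
    then have "subseq zs (ps @ as) \<or> subseq zs (ps @ bs)"
      using z by (auto simp: list_emb_append_mono)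
    then show ?thesis
      using zs(2) assms(1,2) by (blast dest: altitude_leD)
  next
    case False
    then have "length zs > 1"
      using z(1) by (cases vs; cases ws) auto
    \<comment> \<open>\<open>vs\<close> and \<open>ws\<close> are consecutive pieces of
      \<open>zs\<close>, so their junction is a step of the walk.\<close>
    then have "R (last vs) (hd ws)"
      using zs(2) z(1) False by (auto simp: closed_walk_def successively_append_iff)
    moreover have "last vs \<in> set as" "hd ws \<in> set bs"
      using False z set_mono_subseq by (metis hd_in_set last_in_set subsetD)+
    ultimately show ?thesis
      using no by blast
  qed
qed

subsection \<open>Circular altitude in terms of lists\<close>

definition ordering_list :: "('a, 'b) pre_digraph \<Rightarrow> (nat \<Rightarrow> 'a) \<Rightarrow> 'a list" where
  "ordering_list G U = map U [1..<Suc (card (verts G))]"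

lemma linear_ordering_list:
  assumes "linear_ordering G U"
  shows "distinct (ordering_list G U)" and "set (ordering_list G U) = verts G"
proof -
  have "set [1..<Suc (card (verts G))] = {1..card (verts G)}"
    by auto
  then show "distinct (ordering_list G U)" and "set (ordering_list G U) = verts G"
    using assms unfolding linear_ordering_def bij_betw_def ordering_list_def
    by (auto simp: distinct_map simp del: upt_Suc)
qed

lemma ex_linear_ordering:
  assumes "distinct xs" and "set xs = verts G"
  obtains U where "linear_ordering G U" and "ordering_list G U = xs"
proof
  \<comment> \<open>Orderings count from 1, list positions from 0.\<close>
  let ?U = "\<lambda>i. xs ! (i - 1)"
  have n: "card (verts G) = length xs"
    using assms distinct_card by metis
  show eq: "ordering_list G ?U = xs"
    unfolding ordering_list_def n by (rule nth_equalityI) (simp_all del: upt_Suc)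
  have "set [1..<Suc (card (verts G))] = {1..card (verts G)}"
    by auto
  moreover have "distinct (map ?U [1..<Suc (card (verts G))])"
    and "set (map ?U [1..<Suc (card (verts G))]) = verts G"
    using eq assms unfolding ordering_list_def by simp_all
  ultimately show "linear_ordering G ?U"
    unfolding linear_ordering_def bij_betw_def distinct_map set_map by simp
qed

lemma monotonic_cycle_imp_closed_walk:
  assumes "monotonic_cycle G U ks"
  shows "subseq (map U ks) (ordering_list G U)" and "closed_walk (\<lambda>u v. u \<rightarrow>\<^bsub>G\<^esub> v) (map U ks)"
proof -
  \<comment> \<open>For length 1 the definition imposes no order, but a singleton is sorted anyway;
    hence the case split.\<close>
  have "sorted_wrt (<) ks"
    using assms unfolding monotonic_cycle_def by (cases ks; cases "tl ks") auto
  then have "sorted ks" "distinct ks"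
    by (simp_all add: strict_sorted_iff)
  moreover have "set ks \<subseteq> set [1..<Suc (card (verts G))]"
    using assms unfolding monotonic_cycle_def by auto
  ultimately have "subseq ks [1..<Suc (card (verts G))]"
    by (intro sorted_subset_imp_subseq) (auto simp: strict_sorted_iff simp del: upt_Suc)
  then show "subseq (map U ks) (ordering_list G U)"
    unfolding ordering_list_def by (rule subseq_map)
  show "closed_walk (\<lambda>u v. u \<rightarrow>\<^bsub>G\<^esub> v) (map U ks)"
    using assms unfolding monotonic_cycle_def closed_walk_map by auto
qed

text \<open>The positions \<open>N\<close> that select \<open>ys\<close> from the ordering select
  the wanted indices from the index range.\<close>

lemma closed_walk_imp_monotonic_cycle:
  assumes "linear_ordering G U" "subseq ys (ordering_list G U)"
    and "closed_walk (\<lambda>u v. u \<rightarrow>\<^bsub>G\<^esub> v) ys"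
  obtains ks where "monotonic_cycle G U ks" and "ys = map U ks"
proof -
  obtain N where "ys = nths (ordering_list G U) N"
    using assms(2) by (auto simp: subseq_conv_nths)
  then obtain ks where ks: "ys = map U ks" "ks = nths [1..<Suc (card (verts G))] N"
    unfolding ordering_list_def by (simp add: nths_map del: upt_Suc)
  have "sorted_wrt (<) ks"
    unfolding ks(2) by (simp add: strict_sorted_iff sorted_nths distinct_nthsI del: upt_Suc)
  moreover have "set ks \<subseteq> {1..card (verts G)}"
    unfolding ks(2) using set_nths_subset[of "[1..<Suc (card (verts G))]" N] by auto
  moreover have "distinct ys"
    using assms(1,2) linear_ordering_list(1) by (auto simp: subseq_conv_nths intro: distinct_nthsI)
  ultimately have "monotonic_cycle G U ks"
    using assms(3) unfolding ks(1) monotonic_cycle_def closed_walk_map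
    by (simp add: Suc_le_eq)
  then show ?thesis
    using that ks(1) by blast
qed

lemma ordering_altitude_le_iff:
  assumes "linear_ordering G U" and "finite (verts G)" and "verts G \<noteq> {}"
  shows "ordering_altitude G U \<le> k \<longleftrightarrow> altitude_le (\<lambda>u v. u \<rightarrow>\<^bsub>G\<^esub> v) (ordering_list G U) k"
proof -
  let ?L = "{length ks |ks. monotonic_cycle G U ks}"
  have "length ks \<le> card (verts G)" if "monotonic_cycle G U ks" for ks
    using monotonic_cycle_imp_closed_walk(1)[OF that]
    by (auto simp: ordering_list_def simp del: upt_Suc dest!: list_emb_length)
  then have fin: "finite ?L"
    by (auto intro: finite_subset[of _ "{..card (verts G)}"])
  \<comment> \<open>The one-vertex cycle keeps \<open>Max\<close> from ranging over the empty
    set.\<close>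
  have "monotonic_cycle G U [1]"
    using assms(2,3) by (auto simp: monotonic_cycle_def Suc_le_eq card_gt_0_iff)
  then have "?L \<noteq> {}"
    by blast
  with fin have "ordering_altitude G U \<le> k \<longleftrightarrow> (\<forall>ks. monotonic_cycle G U ks \<longrightarrow> length ks \<le> k)"
    unfolding ordering_altitude_def by (subst Max_le_iff) auto
  also have "\<dots> \<longleftrightarrow> altitude_le (\<lambda>u v. u \<rightarrow>\<^bsub>G\<^esub> v) (ordering_list G U) k"
    unfolding altitude_le_def
    by (metis assms(1) closed_walk_imp_monotonic_cycle length_map monotonic_cycle_imp_closed_walk)
  finally show ?thesis .
qed

lemma circular_altitude_le_iff:
  assumes "finite (verts G)" and "verts G \<noteq> {}"
  shows "circular_altitude G \<le> k \<longleftrightarrow>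
    (\<exists>xs. distinct xs \<and> set xs = verts G \<and> altitude_le (\<lambda>u v. u \<rightarrow>\<^bsub>G\<^esub> v) xs k)"
proof -
  let ?A = "{ordering_altitude G U |U. linear_ordering G U}"
  \<comment> \<open>An ordering is a function on all of \<open>nat\<close> with arbitrary values
    outside the index range, so finiteness of \<open>?A\<close> is derived from a bound on its
    members.\<close>
  have "ordering_altitude G U \<le> card (verts G)" if U: "linear_ordering G U" for U
    unfolding ordering_altitude_le_iff[OF U assms]
    by (auto simp: altitude_le_def ordering_list_def simp del: upt_Suc dest!: list_emb_length)
  then have fin: "finite ?A"
    by (auto intro: finite_subset[of _ "{..card (verts G)}"])
  obtain xs where "distinct xs" "set xs = verts G"
    using finite_distinct_list[OF assms(1)] by blast
  then have "?A \<noteq> {}"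
    by (auto elim!: ex_linear_ordering)
  with fin have "circular_altitude G \<le> k \<longleftrightarrow> (\<exists>U. linear_ordering G U \<and> ordering_altitude G U \<le> k)"
    unfolding circular_altitude_def by (subst Min_le_iff) auto
  also have "\<dots> \<longleftrightarrow>
    (\<exists>xs. distinct xs \<and> set xs = verts G \<and> altitude_le (\<lambda>u v. u \<rightarrow>\<^bsub>G\<^esub> v) xs k)"
    using ordering_altitude_le_iff[OF _ assms] linear_ordering_list ex_linear_ordering by metis
  finally show ?thesis .
qed

lemma circular_altitude_subgraph:
  assumes "subgraph H G" and "finite (verts G)" and "verts H \<noteq> {}"
  shows "circular_altitude H \<le> circular_altitude G"
proof -
  have sub: "verts H \<subseteq> verts G"
    using assms(1) by auto
  then have finH: "finite (verts H)" and "verts G \<noteq> {}"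
    using assms finite_subset by auto
  \<comment> \<open>Taking \<open>circular_altitude G\<close> itself as \<open>k\<close> yields an
    optimal ordering.\<close>
  then obtain xs where xs: "distinct xs" "set xs = verts G"
    "altitude_le (\<lambda>u v. u \<rightarrow>\<^bsub>G\<^esub> v) xs (circular_altitude G)"
    using circular_altitude_le_iff[OF assms(2)] by blast
  let ?ys = "filter (\<lambda>x. x \<in> verts H) xs"
  have "altitude_le (\<lambda>u v. u \<rightarrow>\<^bsub>G\<^esub> v) ?ys (circular_altitude G)"
    using xs(3) by (rule altitude_le_subseq) simp
  then have "altitude_le (\<lambda>u v. u \<rightarrow>\<^bsub>H\<^esub> v) ?ys (circular_altitude G)"
    by (rule altitude_le_mono) (use arcs_ends_mono[OF assms(1)] in blast)
  moreover have "distinct ?ys" "set ?ys = verts H"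
    using xs sub by auto
  ultimately show ?thesis
    using circular_altitude_le_iff[OF finH assms(3)] by blast
qed

subsection \<open>Separations\<close>

text \<open>\<open>P\<close> holds the cut-vertex, or is empty for a disconnected graph, so both
  cases are handled at once. Having at most one element, it can be rotated to the front of an
  ordering of either side.\<close>

lemma circular_altitude_separation:
  assumes "graph G" and V: "verts G = P \<union> A \<union> B"
    and disj: "A \<inter> B = {}" "P \<inter> A = {}" "P \<inter> B = {}"
    and P: "P = {} \<or> (\<exists>v. P = {v})" and ne: "A \<noteq> {}" "B \<noteq> {}"
    and no: "\<And>a b. a \<in> A \<Longrightarrow> b \<in> B \<Longrightarrow> \<not> a \<rightarrow>\<^bsub>G\<^esub> b"
  shows "circular_altitude G
    \<le> max (circular_altitude (G \<restriction> (P \<union> A))) (circular_altitude (G \<restriction> (P \<union> B)))" (is "_ \<le> ?k")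
proof -
  interpret graph G by fact
  let ?R = "\<lambda>u v. u \<rightarrow>\<^bsub>G\<^esub> v"
  \<comment> \<open>Used for \<open>A\<close> and \<open>B\<close>: an optimal ordering of one side,
    rotated so that \<open>P\<close> comes first. The length condition excludes repetitions in
    \<open>ps\<close>.\<close>
  have part: "\<exists>ps cs. set ps = P \<and> length ps = card P \<and> distinct cs \<and> set cs = C
      \<and> altitude_le ?R (ps @ cs) ?k"
    if C: "C \<noteq> {}" "C \<subseteq> verts G" "P \<inter> C = {}" "circular_altitude (G \<restriction> (P \<union> C)) \<le> ?k" for C
  proof -
    let ?S = "P \<union> C"
    have S: "?S \<subseteq> verts G"
      using C V by auto
    then have "finite (verts (G \<restriction> ?S))" "verts (G \<restriction> ?S) \<noteq> {}"
      using C finite_subset[OF S] by auto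
    then obtain xs where xs: "distinct xs" "set xs = ?S"
      "altitude_le (\<lambda>u v. u \<rightarrow>\<^bsub>G \<restriction> ?S\<^esub> v) xs ?k"
      using circular_altitude_le_iff C(4) by (metis induce_subgraph_verts)
    have alt: "altitude_le ?R xs ?k"
      by (rule altitude_le_mono[OF xs(3)]) (use xs(2) in \<open>auto simp: arcs_ends_conv\<close>)
    show ?thesis
    proof (cases "P = {}")
      case True
      then show ?thesis
        using xs alt by (intro exI[of _ "[]"] exI[of _ xs]) auto
    next
      case False
      then obtain v where v: "P = {v}"
        using P by blast
      then obtain us ws where split: "xs = us @ v # ws"
        using xs(2) by (metis UnI1 insertI1 split_list)
      then have "altitude_le ?R ([v] @ ws @ us) ?k"
        using altitude_le_rotate[of ?R us "v # ws"] alt by simp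
      moreover have "distinct (ws @ us)" "set (ws @ us) = C"
        using xs split v C(3) by auto
      ultimately show ?thesis
        using v by (intro exI[of _ "[v]"] exI[of _ "ws @ us"]) auto
    qed
  qed
  obtain ps as where as: "set ps = P" "length ps = card P" "distinct as" "set as = A"
    "altitude_le ?R (ps @ as) ?k"
    using part[of A] ne V disj by fastforce
  obtain qs bs where bs: "set qs = P" "length qs = card P" "distinct bs" "set bs = B"
    "altitude_le ?R (qs @ bs) ?k"
    using part[of B] ne V disj by fastforce
  \<comment> \<open>With at most one element in \<open>P\<close>, its repetition-free listing is
    unique, so the two orderings share their prefix and can be merged.\<close>
  have "qs = ps"
  proof (cases "P = {}")
    case False
    then obtain v where "P = {v}"
      using P by blast
    then show ?thesis
      using as(1,2) bs(1,2) by (auto simp: length_Suc_conv)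
  qed (use as(1) bs(1) in simp)
  then have "altitude_le ?R (ps @ as @ bs) ?k"
    using altitude_le_append[OF as(5)] as(4) bs(4,5) no by blast
  moreover have "distinct (ps @ as @ bs)"
    using as bs disj by (auto intro: card_distinct)
  moreover have "set (ps @ as @ bs) = verts G"
    using as bs V by auto
  ultimately show ?thesis
    using circular_altitude_le_iff[OF finite_verts, of ?k] ne V by blast
qed

section \<open>Splitting a graph that is not nonseparable\<close>

lemma graph_induce_subgraph:
  assumes "graph G" and "S \<subseteq> verts G"
  shows "graph (G \<restriction> S)"
proof -
  interpret graph G by fact
  have ind: "induced_subgraph (G \<restriction> S) G"
    using assms(2) by blast
  interpret H: digraph "G \<restriction> S"
    using ind by (rule digraphI_induced)
  show ?thesis
    using induced_graph_imp_symmetric[OF sym_arcs ind] by blast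
qed

text \<open>\<open>A\<close> is everything reachable from a vertex that fails to reach some other
  vertex; an edge leaving \<open>A\<close> would extend reachability.\<close>

lemma not_strongly_connected_split:
  assumes "graph G" and "verts G \<noteq> {}" and "\<not> strongly_connected G"
  obtains A B where "verts G = A \<union> B" "A \<inter> B = {}" "A \<noteq> {}" "B \<noteq> {}"
    "\<And>a b. a \<in> A \<Longrightarrow> b \<in> B \<Longrightarrow> \<not> a \<rightarrow>\<^bsub>G\<^esub> b"
proof -
  interpret graph G by fact
  obtain u v where uv: "u \<in> verts G" "v \<in> verts G" "\<not> u \<rightarrow>\<^sup>*\<^bsub>G\<^esub> v"
    using assms(2,3) unfolding strongly_connected_def by blast
  let ?A = "{w. u \<rightarrow>\<^sup>*\<^bsub>G\<^esub> w}"
  show ?thesis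
  proof
    show "verts G = ?A \<union> (verts G - ?A)"
      by (auto dest: reachable_in_verts)
    show "?A \<noteq> {}" "verts G - ?A \<noteq> {}"
      using uv by auto
    show "\<not> a \<rightarrow>\<^bsub>G\<^esub> b" if "a \<in> ?A" "b \<in> verts G - ?A" for a b
      using that reachable_adj_trans by blast
  qed auto
qed

text \<open>\<open>connected\<close> refers to the symmetric closure, which leaves reachability in a
  symmetric digraph unchanged.\<close>

lemma connected_iff_strongly_connected:
  assumes "graph G"
  shows "connected G \<longleftrightarrow> strongly_connected G"
proof -
  interpret graph G by fact
  show ?thesis
    unfolding connected_def strongly_connected_def
    by (simp add: reachable_mk_symmetric_eq[OF sym_arcs])
qed

lemma del_vert_eq_induce_subgraph:
  assumes "wf_digraph G"
  shows "pre_digraph.del_vert G v = G \<restriction> (verts G - {v})"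
proof -
  interpret wf_digraph G by fact
  show ?thesis
    unfolding del_vert_def induce_subgraph_def by auto
qed

text \<open>\<open>G\<close> contains \<open>v\<close> and so has at least one component; hence
  deleting \<open>v\<close> leaves at least two.\<close>

lemma cut_vertex_not_strongly_connected:
  assumes "graph G" and "cut_vertex G v"
  shows "verts G - {v} \<noteq> {}" and "\<not> strongly_connected (G \<restriction> (verts G - {v}))"
proof -
  interpret graph G by fact
  let ?H = "G \<restriction> (verts G - {v})"
  interpret H: graph ?H
    by (rule graph_induce_subgraph[OF assms(1)]) auto
  have v: "v \<in> verts G" and card: "card (pre_digraph.sccs_verts G) < card (pre_digraph.sccs_verts ?H)"
    using assms(2) unfolding cut_vertex_def del_vert_eq_induce_subgraph[OF wf_digraph]
    by (simp_all add: card_sccs_verts H.card_sccs_verts)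
  have "0 < card sccs_verts"
    using scc_of_in_sccs_verts[OF v] finite_sccs_verts by (auto simp: card_gt_0_iff)
  with card have gt: "1 < card H.sccs_verts"
    by simp
  \<comment> \<open>Of two distinct components, at most one is the whole vertex set.\<close>
  then have "\<not> H.sccs_verts \<subseteq> {verts ?H}"
    using card_mono[of "{verts ?H}" H.sccs_verts] by auto
  then obtain S where S: "S \<in> H.sccs_verts" "S \<noteq> verts ?H"
    by blast
  have sub: "S \<subseteq> verts ?H"
    using H.sccs_verts_subsets[OF S(1)] .
  have "S \<noteq> {}"
    using S(1) by (simp add: H.in_sccs_verts_conv_reachable)
  with sub show "verts G - {v} \<noteq> {}"
    by auto
  show "\<not> strongly_connected ?H"
  proof
    assume "strongly_connected ?H"
    \<comment> \<open>A component contains every vertex mutually reachable with one of its own, so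
      such a \<open>y\<close> outside \<open>S\<close> contradicts strong connectedness.\<close>
    moreover obtain x y where xy: "x \<in> S" "y \<in> verts ?H" "y \<notin> S"
      using S(2) sub \<open>S \<noteq> {}\<close> by blast
    ultimately have "x \<rightarrow>\<^sup>*\<^bsub>?H\<^esub> y" "y \<rightarrow>\<^sup>*\<^bsub>?H\<^esub> x"
      using sub unfolding strongly_connected_def by blast+
    then show False
      using S(1) xy unfolding H.in_sccs_verts_conv_reachable by blast
  qed
qed

lemma not_nonseparable_split:
  assumes "graph G" and "verts G \<noteq> {}" and "\<not> nonseparable G"
  obtains P A B where "verts G = P \<union> A \<union> B" "A \<inter> B = {}" "P \<inter> A = {}" "P \<inter> B = {}"
    "P = {} \<or> (\<exists>v. P = {v})" "A \<noteq> {}" "B \<noteq> {}"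
    "\<And>a b. a \<in> A \<Longrightarrow> b \<in> B \<Longrightarrow> \<not> a \<rightarrow>\<^bsub>G\<^esub> b"
proof (cases "strongly_connected G")
  case False
  then obtain A B where "verts G = A \<union> B" "A \<inter> B = {}" "A \<noteq> {}" "B \<noteq> {}"
    "\<And>a b. a \<in> A \<Longrightarrow> b \<in> B \<Longrightarrow> \<not> a \<rightarrow>\<^bsub>G\<^esub> b"
    using not_strongly_connected_split[OF assms(1,2)] by blast
  then show ?thesis
    using that[of "{}" A B] by simp
next
  case True
  then obtain v where v: "cut_vertex G v"
    using assms connected_iff_strongly_connected unfolding nonseparable_def by blast
  let ?H = "G \<restriction> (verts G - {v})"
  have "graph ?H"
    by (rule graph_induce_subgraph[OF assms(1)]) auto
  then obtain A B where AB: "verts ?H = A \<union> B" "A \<inter> B = {}" "A \<noteq> {}" "B \<noteq> {}"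
    and no: "\<And>a b. a \<in> A \<Longrightarrow> b \<in> B \<Longrightarrow> \<not> a \<rightarrow>\<^bsub>?H\<^esub> b"
    using not_strongly_connected_split[of ?H] cut_vertex_not_strongly_connected[OF assms(1) v]
    by (metis induce_subgraph_verts)
  \<comment> \<open>Neither \<open>a\<close> nor \<open>b\<close> is \<open>v\<close>, so an edge
    between them would survive in \<open>?H\<close>.\<close>
  have "\<not> a \<rightarrow>\<^bsub>G\<^esub> b" if "a \<in> A" "b \<in> B" for a b
    using no[OF that] AB(1) that by (fastforce simp: arcs_ends_conv)
  moreover have "v \<in> verts G"
    using v by (simp add: cut_vertex_def)
  ultimately show ?thesis
    using that[of "{v}" A B] AB by auto
qed

section \<open>Descent to a nonseparable subgraph and extension to a block\<close>

lemma ex_nonseparable_subgraph: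
  assumes "graph G" and "verts G \<noteq> {}"
  shows "\<exists>H. nonseparable_subgraph H G \<and> circular_altitude G \<le> circular_altitude H"
  using assms
proof (induction "card (verts G)" arbitrary: G rule: less_induct)
  case less
  interpret graph G by fact
  show ?case
  proof (cases "nonseparable G")
    case True
    then show ?thesis
      using less.prems(1) subgraph_refl unfolding nonseparable_subgraph_def by blast
  next
    case False
    then obtain P A B where V: "verts G = P \<union> A \<union> B"
      and disj: "A \<inter> B = {}" "P \<inter> A = {}" "P \<inter> B = {}"
      and P: "P = {} \<or> (\<exists>v. P = {v})" and ne: "A \<noteq> {}" "B \<noteq> {}"
      and no: "\<And>a b. a \<in> A \<Longrightarrow> b \<in> B \<Longrightarrow> \<not> a \<rightarrow>\<^bsub>G\<^esub> b"
      using not_nonseparable_split[OF less.prems False] by metis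
    obtain C where C: "C = P \<union> A \<or> C = P \<union> B" "circular_altitude G \<le> circular_altitude (G \<restriction> C)"
      using circular_altitude_separation[OF less.prems(1) V disj P ne no] by (auto simp: le_max_iff_disj)
    \<comment> \<open>Strict because the other side is nonempty and disjoint from \<open>C\<close>;
      this drives the induction on the number of vertices.\<close>
    then have sub: "C \<subset> verts G" "C \<noteq> {}"
      using V disj ne by auto
    have "card (verts (G \<restriction> C)) < card (verts G)"
      using psubset_card_mono[OF _ sub(1)] by simp
    then obtain H where H: "nonseparable_subgraph H (G \<restriction> C)"
      "circular_altitude (G \<restriction> C) \<le> circular_altitude H"
      using less.hyps[of "G \<restriction> C"] graph_induce_subgraph[OF less.prems(1)] sub by auto
    have "subgraph (G \<restriction> C) G"
      using sub by (intro subgraph_induce_subgraphI) auto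
    then have "nonseparable_subgraph H G"
      using H(1) subgraph_trans unfolding nonseparable_subgraph_def by blast
    then show ?thesis
      using H(2) C(2) by (meson order_trans)
  qed
qed

lemma ex_block_supergraph:
  assumes "graph G" and "nonseparable_subgraph H G"
  obtains B where "block B G" and "subgraph H B"
proof -
  interpret graph G by fact
  \<comment> \<open>A proper supergraph may have the same vertices, so arcs are counted too. A
    maximiser of \<open>?f\<close> among the nonseparable subgraphs above \<open>H\<close> will be
    the block.\<close>
  let ?f = "\<lambda>B. card (verts B) + card (arcs B)"
  let ?Q = "\<lambda>B. nonseparable_subgraph B G \<and> subgraph H B"
  have "wf_digraph H"
    using assms(2) by (auto simp: nonseparable_subgraph_def)
  then have "?Q H"
    using assms(2) wf_digraph.subgraph_refl by blast
  moreover have "\<forall>B. ?Q B \<longrightarrow> ?f B < Suc (?f G)"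
    by (auto simp: nonseparable_subgraph_def less_Suc_eq_le intro!: add_mono card_mono)
  ultimately obtain B where B: "?Q B" and max: "\<And>B'. ?Q B' \<Longrightarrow> ?f B' \<le> ?f B"
    using ex_has_greatest_nat[of ?Q H ?f "Suc (?f G)"] by blast
  have "K = B" if K: "nonseparable_subgraph K G" "subgraph B K" for K
  proof -
    have "?f K \<le> ?f B"
      using B K subgraph_trans by (intro max) blast
    moreover have fin: "finite (verts K)" "finite (arcs K)"
      using K(1) finite_subset[OF _ finite_verts] finite_subset[OF _ finite_arcs]
      by (auto simp: nonseparable_subgraph_def)
    moreover have sub: "verts B \<subseteq> verts K" "arcs B \<subseteq> arcs K" "compatible K B"
      using K(2) by auto
    moreover have "card (verts B) \<le> card (verts K)" "card (arcs B) \<le> card (arcs K)"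
      using fin sub by (auto intro: card_mono)
    ultimately have "card (verts K) \<le> card (verts B)" "card (arcs K) \<le> card (arcs B)"
      by linarith+
    then have "verts B = verts K" "arcs B = arcs K"
      using fin sub by (simp_all add: card_seteq)
    then show ?thesis
      \<comment> \<open>Graphs are records that also carry \<open>tail\<close> and
        \<open>head\<close>; \<open>compatible\<close> identifies these.\<close>
      using sub(3) by (intro pre_digraph.equality) (auto simp: compatible_def)
  qed
  then have "block B G"
    using B unfolding block_def by blast
  then show ?thesis
    using that B by blast
qed

theorem theorem1:
  fixes G :: "('a, 'b) pre_digraph"
  assumes "graph G" and "verts G \<noteq> {}"
  shows "circular_altitude G = Max {circular_altitude B |B. block B G}"
proof -
  interpret graph G by fact
  have ne: "verts H \<noteq> {}" if "nonseparable_subgraph H G" for H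
    using that unfolding nonseparable_subgraph_def nonseparable_def connected_def strongly_connected_def
    by auto
  have le: "circular_altitude B \<le> circular_altitude G" if "block B G" for B
    using that ne circular_altitude_subgraph[of B G] unfolding block_def nonseparable_subgraph_def
    by auto
  obtain H where H: "nonseparable_subgraph H G" "circular_altitude G \<le> circular_altitude H"
    using ex_nonseparable_subgraph[OF assms] by blast
  obtain B where B: "block B G" "subgraph H B"
    using ex_block_supergraph[OF assms(1) H(1)] .
  have "finite (verts B)"
    using B(1) finite_subset[OF _ finite_verts] by (auto simp: block_def nonseparable_subgraph_def)
  then have "circular_altitude H \<le> circular_altitude B"
    using circular_altitude_subgraph[OF B(2)] ne[OF H(1)] by blast
  \<comment> \<open>The altitudes of \<open>G\<close>, \<open>H\<close>, \<open>B\<close> and again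
    \<open>G\<close> form a circular chain of inequalities, so this block attains the bound.\<close>
  then have eq: "circular_altitude B = circular_altitude G"
    using H(2) le[OF B(1)] by simp
  show ?thesis
  proof (rule Max_eqI[symmetric])
    show "finite {circular_altitude B |B. block B G}"
      \<comment> \<open>The common upper bound also makes the set of values finite.\<close>
      using le by (auto intro: finite_subset[of _ "{..circular_altitude G}"])
    show "circular_altitude G \<in> {circular_altitude B |B. block B G}"
      unfolding eq[symmetric] using B(1) by blast
  qed (use le in blast)
qed

end
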